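(* Let $G$ be any finite graph. If we equip $G$ with the resistance distance, then it admits the microscopic weighting $\widehat{\mathbf{w}}=\kappa$, where $\kappa$ is the vector of resistance curvatures of $G$.
   Context: Let $G$ be a graph with vertices $v_1,\dots,v_n$. The resistance distance is the metric on the vertex set in which the distance between two vertices is the effective resistance between the two nodes in the electrical network corresponding to $G$ (each edge being regarded as a resistor). It is known to be of strictly negative type: writing $\Omega=(\Omega_{v_i,v_j})_{i,j}$ for its distance matrix, $\mathbf{u}^{\mathrm T}\Omega\mathbf{u}<0$ for every nonzero $\mathbf{u}\in\mathbb{R}^n$ whose entries sum to $0$. Write $\mathbf{1}=(1,\dots,1)^{\mathrm T}\in\mathbb{R}^n$. The resistance curvature (after Devriendt and Lambiotte) is defined as follows: $\kappa\in\mathbb{R}^n$ is the unique vector that satisfies $$\Omega\kappa=\frac{1}{\kappa^{\mathrm T}\Omega\kappa}\,\mathbf{1},$$ and the resistance curvature at the vertex $v_i$ is the number $\kappa_i$. For all sufficiently small $t>0$ the matrix $Z(t)=(\exp(-t\,\Omega_{v_i,v_j}))_{i,j}$ is invertible; put $\mathbf{w}(t)=Z(t)^{-1}\mathbf{1}$. The graph with the resistance distance admits a microscopic weighting if $\widehat{\mathbf{w}}:=\lim_{t\to0}\mathbf{w}(t)$ (as $t$ decreases to $0$) exists componentwise in $\mathbb{R}^n$; then $\widehat{\mathbf{w}}$ is the microscopic weighting.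
   Formalization: The printed equation for κ makes the claim false (for a single edge it gives entries 2^{-1/3}, but the limit is 1/2); κ is instead defined by Ωκ = (κᵀΩκ)1 with entries summing to 1; the graph is taken connected, so that the resistance distance is finite. *)

theory Defs
  imports "HOL-Analysis.Analysis" "Graph_Theory.Graph_Theory"
begin

text \<open>
  A finite simple graph is a symmetric loop-free digraph without parallel arcs
  (\<^locale>\<open>pair_graph\<close>), so an edge between \<open>x\<close> and \<open>y\<close> occurs as both \<open>(x, y)\<close> and \<open>(y, x)\<close>.
  Every edge is a resistor of one ohm: by Ohm's law the current from \<open>x\<close> to \<open>y\<close> is \<open>p x - p y\<close>,
  where \<open>p\<close> is the potential. The condition below is Kirchhoff's current law when a current of
  one ampere enters the network at \<open>a\<close> and leaves it at \<open>b\<close>.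
\<close>

definition unit_current_potential ::
    "'a pair_pre_digraph \<Rightarrow> 'a \<Rightarrow> 'a \<Rightarrow> ('a \<Rightarrow> real) \<Rightarrow> bool" where
  "unit_current_potential G a b p \<longleftrightarrow>
     (\<forall>x\<in>pverts G. (\<Sum>y | (x, y) \<in> parcs G. p x - p y) = of_bool (x = a) - of_bool (x = b))"

text \<open>
  In a connected graph the potential exists and is unique up to an additive constant, so the
  potential difference is well defined.
\<close>

definition effective_resistance :: "'a pair_pre_digraph \<Rightarrow> 'a \<Rightarrow> 'a \<Rightarrow> real" where
  "effective_resistance G a b =
     (THE r. \<exists>p. unit_current_potential G a b p \<and> r = p a - p b)"

definition resistance_matrix :: "'n pair_pre_digraph \<Rightarrow> real ^ 'n ^ 'n" where
  "resistance_matrix G = (\<chi> i j. effective_resistance G i j)"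

text \<open>
  The normalisation is that of Devriendt and Lambiotte: \<open>\<Omega>\<kappa>\<close> is a multiple of the all-ones
  vector and the entries of \<open>\<kappa>\<close> sum to 1. The multiple is then \<open>\<kappa>\<^sup>T\<Omega>\<kappa>\<close>, which for at least
  two vertices is the reciprocal of \<open>1\<^sup>T \<Omega>\<^sup>-\<^sup>1 1\<close>. The equation is sometimes printed with the factor
  \<open>1 / (\<kappa>\<^sup>T\<Omega>\<kappa>)\<close> instead. Read literally, that describes a different multiple of \<open>\<kappa>\<close>, whose entries
  do not sum to 1 in general (for one edge, both entries would be the real cube root of 1/2
  rather than 1/2). The explicit condition on the sum excludes the zero solution, and also makes
  the definition meaningful for the graph with one vertex, where \<open>\<Omega> = 0\<close>.
\<close>

definition is_resistance_curvature :: "real ^ 'n ^ 'n \<Rightarrow> real ^ 'n \<Rightarrow> bool" where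
  "is_resistance_curvature \<Omega> \<kappa> \<longleftrightarrow>
     \<Omega> *v \<kappa> = (\<kappa> \<bullet> (\<Omega> *v \<kappa>)) *\<^sub>R 1 \<and> (\<Sum>i\<in>UNIV. \<kappa> $ i) = 1"

definition resistance_curvature :: "'n::finite pair_pre_digraph \<Rightarrow> real ^ 'n" where
  "resistance_curvature G = (THE \<kappa>. is_resistance_curvature (resistance_matrix G) \<kappa>)"

definition similarity_matrix :: "real ^ 'n ^ 'n \<Rightarrow> real \<Rightarrow> real ^ 'n ^ 'n" where
  "similarity_matrix D t = (\<chi> i j. exp (- t * D $ i $ j))"

definition weighting :: "real ^ 'n ^ 'n \<Rightarrow> real \<Rightarrow> real ^ 'n" where
  "weighting D t = matrix_inv (similarity_matrix D t) *v 1"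

text \<open>
  \<^const>\<open>matrix_inv\<close> is unspecified on singular matrices, so that the similarity matrix is
  invertible for all small scales is part of the definition.
\<close>

definition admits_microscopic_weighting :: "real ^ 'n ^ 'n \<Rightarrow> bool" where
  "admits_microscopic_weighting D \<longleftrightarrow>
     (\<forall>\<^sub>F t in at_right 0. invertible (similarity_matrix D t)) \<and>
     (\<exists>w. (weighting D \<longlongrightarrow> w) (at_right 0))"

definition microscopic_weighting :: "real ^ 'n ^ 'n \<Rightarrow> real ^ 'n" where
  "microscopic_weighting D = Lim (at_right 0) (weighting D)"

end

theory Submission
  imports Defs
begin

text \<open>
  Write \<open>Z(t) = J - t D(t)\<close>, where \<open>J\<close> is the all-ones matrix and \<open>D(t) \<rightarrow> D\<close>. Then \<open>Z(t) w = 1\<close> is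
  equivalent to the bordered linear system \<open>D(t) w - c 1 = 0\<close>, \<open>1\<^sup>Tw - t c = 1\<close>. At \<open>t = 0\<close> this system
  characterises the resistance curvature, and strict negative type makes it nonsingular. Hence
  it is nonsingular for all small \<open>t\<close>, with solutions converging to the one at \<open>t = 0\<close>.
  The resistance matrix is of strict negative type because
  \<open>\<Omega>\<^sub>a\<^sub>b = H\<^sub>a\<^sub>a + H\<^sub>b\<^sub>b - 2H\<^sub>a\<^sub>b\<close> for the positive definite inverse \<open>H\<close> of the Laplacian plus \<open>J\<close>.
\<close>

section \<open>The microscopic weighting of a matrix of strict negative type\<close>

text \<open>The matrix is a separate parameter so that one operator covers both the limit system,
  with \<open>D\<close> and \<open>t = 0\<close>, and the perturbed one, with
  \<open>similarity_slope D t\<close>.\<close>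

definition bordered :: "real ^ 'n ^ 'n \<Rightarrow> real \<Rightarrow> (real ^ 'n::finite) \<times> real \<Rightarrow> (real ^ 'n) \<times> real" where
  "bordered A t x = (A *v fst x - snd x *\<^sub>R 1, fst x \<bullet> 1 - t * snd x)"

definition strict_negative_type :: "real ^ 'n ^ 'n \<Rightarrow> bool" where
  "strict_negative_type D \<longleftrightarrow> (\<forall>u. u \<bullet> 1 = 0 \<longrightarrow> u \<noteq> 0 \<longrightarrow> u \<bullet> (D *v u) < 0)"

text \<open>The matrix \<open>D(t)\<close> with \<open>Z(t) = J - t D(t)\<close> for nonzero
  \<open>t\<close>, where \<open>J\<close> is the all-ones matrix.\<close>

definition similarity_slope :: "real ^ 'n ^ 'n \<Rightarrow> real \<Rightarrow> real ^ 'n ^ 'n" where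
  "similarity_slope D t = (\<chi> i j. (1 - exp (- t * D $ i $ j)) / t)"

lemma inner_one_vec: "u \<bullet> 1 = (\<Sum>i\<in>UNIV. u $ i)" for u :: "real ^ 'n"
  by (simp add: inner_vec_def)

lemma linear_bordered: "linear (bordered A t)"
  by (rule linearI)
    (auto simp: bordered_def matrix_vector_right_distrib matrix_vector_mult_scaleR
      inner_add_left algebra_simps)

text \<open>For \<open>(u, c)\<close> in the kernel, \<open>D u\<close> is a multiple of the
  all-ones vector, to which \<open>u\<close> is orthogonal. The quadratic form thus vanishes at
  \<open>u\<close>, which forces \<open>u = 0\<close> and then \<open>c = 0\<close>.\<close>

lemma inj_bordered:
  assumes "strict_negative_type D"
  shows "inj (bordered D 0)"
proof -
  have "x = 0" if "bordered D 0 x = 0" for x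
  proof -
    have D: "D *v fst x = snd x *\<^sub>R 1" and s: "fst x \<bullet> 1 = 0"
      using that by (auto simp: bordered_def prod_eq_iff)
    have "fst x \<bullet> (D *v fst x) = 0"
      by (simp add: D s)
    with assms s have f: "fst x = 0"
      by (auto simp: strict_negative_type_def)
    with D have "snd x *\<^sub>R (1 :: real ^ 'a) = 0"
      by simp
    then have "snd x = 0"
      by (auto simp: vec_eq_iff)
    with f show ?thesis
      by (simp add: prod_eq_iff)
  qed
  then show ?thesis
    by (simp add: linear_injective_0[OF linear_bordered])
qed

text \<open>Perturbation bound: the sum of absolute entries dominates the operator norm of
  \<open>A - D\<close>.\<close>

lemma norm_bordered_diff_le:
  "norm (bordered A t x - bordered D 0 x)
    \<le> ((\<Sum>i\<in>UNIV. \<Sum>j\<in>UNIV. \<bar>A $ i $ j - D $ i $ j\<bar>) + \<bar>t\<bar>) * norm x"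
proof -
  have "bordered A t x - bordered D 0 x = ((A - D) *v fst x, - t * snd x)"
    by (simp add: bordered_def matrix_vector_mult_diff_rdistrib)
  then have "norm (bordered A t x - bordered D 0 x)
      \<le> norm ((A - D) *v fst x) + \<bar>t\<bar> * \<bar>snd x\<bar>"
    using norm_Pair_le[of "(A - D) *v fst x" "- t * snd x"] by (simp add: abs_mult)
  also have "norm ((A - D) *v fst x) \<le> onorm ((*v) (A - D)) * norm (fst x)"
    by (rule onorm) (simp add: matrix_vector_mul_bounded_linear)
  also have "\<dots> \<le> (\<Sum>i\<in>UNIV. \<Sum>j\<in>UNIV. \<bar>A $ i $ j - D $ i $ j\<bar>) * norm x"
    using onorm_le_matrix_component_sum[of "A - D"]
    by (intro mult_mono) (auto intro!: sum_nonneg simp: norm_fst_le[of "fst x" "snd x", simplified])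
  also have "\<bar>t\<bar> * \<bar>snd x\<bar> \<le> \<bar>t\<bar> * norm x"
    using norm_snd_le[of "snd x" "fst x"] by (intro mult_left_mono) auto
  finally show ?thesis
    by (simp add: algebra_simps)
qed

lemma tendsto_slope_exp: "((\<lambda>t. (1 - exp (- t * d)) / t) \<longlongrightarrow> d) (at_right 0)" for d :: real
proof -
  have "((\<lambda>t. 1 - exp (- t * d)) has_field_derivative d) (at 0)"
    by (auto intro!: derivative_eq_intros)
  then show ?thesis
    by (auto simp: has_field_derivative_iff elim: tendsto_within_subset)
qed

text \<open>
  The auxiliary unknown is \<open>c = (1\<^sup>Tw - s) / t\<close>; it stays bounded as \<open>t\<close> tends to 0, whereas
  the similarity matrix itself degenerates to the all-ones matrix.
\<close>
lemma bordered_similarity_slope: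
  assumes "t \<noteq> 0" "similarity_matrix D t *v w = s *\<^sub>R 1"
  shows "bordered (similarity_slope D t) t (w, (w \<bullet> 1 - s) / t) = (0, s)"
proof -
  have "(\<Sum>j\<in>UNIV. exp (- t * D $ i $ j) * w $ j) = s" for i
    using arg_cong[OF assms(2), of "\<lambda>v. v $ i"]
    by (simp add: matrix_vector_mult_def similarity_matrix_def)
  then have "(similarity_slope D t *v w) $ i = (w \<bullet> 1 - s) / t" for i
    by (simp add: matrix_vector_mult_def similarity_slope_def inner_one_vec
        left_diff_distrib sum_subtractf flip: sum_divide_distrib)
  then show ?thesis
    using assms(1) by (simp add: bordered_def vec_eq_iff)
qed

lemma invertible_iff_trivial_kernel:
  "invertible A \<longleftrightarrow> (\<forall>x. A *v x = 0 \<longrightarrow> x = 0)" for A :: "real ^ 'n ^ 'n"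
  by (simp add: invertible_left_inverse matrix_left_invertible_ker)

lemma mult_matrix_inv:
  assumes "invertible A"
  shows "A *v (matrix_inv A *v x) = x"
proof -
  have "A ** matrix_inv A = mat 1"
    using someI_ex[OF assms[unfolded invertible_def]] by (simp add: matrix_inv_def)
  then show ?thesis
    by (simp add: matrix_vector_mul_assoc)
qed

text \<open>Pairing \<open>D v = c 1\<close> with \<open>v\<close>, whose entries sum to 1, forces
  \<open>c\<close> to be the quadratic form at \<open>v\<close>.\<close>

lemma bordered_eq_iff_curvature:
  "(\<exists>c. bordered D 0 (v, c) = (0, 1)) \<longleftrightarrow> is_resistance_curvature D v"
proof
  assume "\<exists>c. bordered D 0 (v, c) = (0, 1)"
  then obtain c where "D *v v = c *\<^sub>R 1" "v \<bullet> 1 = 1"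
    by (auto simp: bordered_def)
  then show "is_resistance_curvature D v"
    by (simp add: is_resistance_curvature_def inner_one_vec)
qed (auto simp: is_resistance_curvature_def bordered_def inner_one_vec)

theorem microscopic_weighting_of_strict_negative_type:
  fixes D :: "real ^ 'n ^ 'n"
  assumes "strict_negative_type D"
  shows "\<exists>\<kappa>. (\<forall>v. is_resistance_curvature D v \<longleftrightarrow> v = \<kappa>) \<and>
    (\<forall>\<^sub>F t in at_right 0. invertible (similarity_matrix D t)) \<and>
    (weighting D \<longlongrightarrow> \<kappa>) (at_right 0)"
proof -
  note inj = inj_bordered[OF assms]
  have "surj (bordered D 0)"
    by (rule linear_injective_imp_surjective[OF linear_bordered inj]) (rule refl)
  then obtain \<kappa> c where \<kappa>: "bordered D 0 (\<kappa>, c) = (0, 1)"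
    by (metis surjD surj_pair)
  have curv: "is_resistance_curvature D v \<longleftrightarrow> v = \<kappa>" for v
    unfolding bordered_eq_iff_curvature[symmetric] using \<kappa> inj by (metis injD prod.inject)
  \<comment> \<open>An injective linear map in finite dimension is bounded below; \<open>B\<close>
    measures how much perturbation it tolerates.\<close>
  obtain B where B: "B > 0" "\<And>x. B * norm x \<le> norm (bordered D 0 x)"
    using linear_inj_bounded_below_pos[OF linear_bordered inj] by metis
  define \<epsilon> where
    "\<epsilon> t = (\<Sum>i\<in>UNIV. \<Sum>j\<in>UNIV. \<bar>similarity_slope D t $ i $ j - D $ i $ j\<bar>) + \<bar>t\<bar>" for t
  let ?F = "\<lambda>t. bordered (similarity_slope D t) t"
  have diff: "norm (?F t x - bordered D 0 x) \<le> \<epsilon> t * norm x" for t x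
    unfolding \<epsilon>_def by (rule norm_bordered_diff_le)
  have "(\<epsilon> \<longlongrightarrow> (\<Sum>i\<in>UNIV. \<Sum>j\<in>UNIV. \<bar>D $ i $ j - D $ i $ j\<bar>) + \<bar>0\<bar>) (at_right 0)"
    unfolding \<epsilon>_def similarity_slope_def vec_lambda_beta
    by (intro tendsto_intros tendsto_slope_exp)
  then have \<epsilon>0: "(\<epsilon> \<longlongrightarrow> 0) (at_right 0)"
    by simp
  then have "\<forall>\<^sub>F t in at_right 0. \<epsilon> t < B / 2"
    using B(1) by (intro order_tendstoD(2)) auto
  then have small: "\<forall>\<^sub>F t in at_right 0. \<epsilon> t < B / 2 \<and> t > 0"
    using eventually_at_right_less[of 0] by eventually_elim auto
  \<comment> \<open>A perturbation smaller than \<open>B / 2\<close> leaves half of the lower bound,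
    uniformly in \<open>t\<close>.\<close>
  have below: "B / 2 * norm x \<le> norm (?F t x)" if "\<epsilon> t < B / 2" for t x
  proof -
    have "B * norm x \<le> norm (?F t x) + norm (?F t x - bordered D 0 x)"
      using B(2)[of x] norm_triangle_sub[of "bordered D 0 x" "?F t x"]
      by (simp add: norm_minus_commute)
    also have "\<dots> \<le> norm (?F t x) + B / 2 * norm x"
      using diff[of t x] that by (smt (verit) mult_right_mono norm_ge_zero)
    finally show ?thesis
      by simp
  qed
  have inv: "invertible (similarity_matrix D t)" if t: "\<epsilon> t < B / 2 \<and> t > 0" for t
    unfolding invertible_iff_trivial_kernel
  proof safe
    fix x assume "similarity_matrix D t *v x = 0"
    \<comment> \<open>With \<open>s = 0\<close>, a kernel vector of the similarity matrix extends to
      one of the bordered operator.\<close>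
    then have "?F t (x, (x \<bullet> 1 - 0) / t) = (0, 0)"
      using t by (intro bordered_similarity_slope) auto
    with below[of t "(x, (x \<bullet> 1 - 0) / t)"] t B(1) show "x = 0"
      by (auto simp: mult_le_0_iff zero_prod_def)
  qed
  have bound: "norm (weighting D t - \<kappa>) \<le> \<epsilon> t * (2 * norm (\<kappa>, c) / B)"
    if t: "\<epsilon> t < B / 2 \<and> t > 0" for t
  proof -
    define x where "x = (weighting D t, (weighting D t \<bullet> 1 - 1) / t)"
    have "similarity_matrix D t *v weighting D t = 1 *\<^sub>R 1"
      using inv[OF t] by (simp add: weighting_def mult_matrix_inv)
    then have x: "?F t x = (0, 1)"
      unfolding x_def using t by (intro bordered_similarity_slope) auto
    have "B / 2 * norm (weighting D t - \<kappa>) \<le> B / 2 * norm (x - (\<kappa>, c))"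
      using B(1) norm_fst_le[of "weighting D t - \<kappa>" "snd x - c"]
      by (intro mult_left_mono) (auto simp: x_def)
    also have "\<dots> \<le> norm (?F t (x - (\<kappa>, c)))"
      using t by (intro below) simp
    \<comment> \<open>Both systems have the right-hand side \<open>(0, 1)\<close>, so only the
      perturbation applied to the fixed vector \<open>(\<kappa>, c)\<close> remains.\<close>
    also have "?F t (x - (\<kappa>, c)) = - (?F t (\<kappa>, c) - bordered D 0 (\<kappa>, c))"
      by (simp add: linear_diff[OF linear_bordered] x \<kappa>)
    also have "norm \<dots> \<le> \<epsilon> t * norm (\<kappa>, c)"
      unfolding norm_minus_cancel by (rule diff)
    finally show ?thesis
      using B(1) by (simp add: field_simps)
  qed
  have "((\<lambda>t. weighting D t - \<kappa>) \<longlongrightarrow> 0) (at_right 0)"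
  proof (rule Lim_null_comparison)
    show "\<forall>\<^sub>F t in at_right 0. norm (weighting D t - \<kappa>) \<le> \<epsilon> t * (2 * norm (\<kappa>, c) / B)"
      using small by eventually_elim (rule bound)
    show "((\<lambda>t. \<epsilon> t * (2 * norm (\<kappa>, c) / B)) \<longlongrightarrow> 0) (at_right 0)"
      using \<epsilon>0 by (rule tendsto_mult_left_zero)
  qed
  then have "(weighting D \<longlongrightarrow> \<kappa>) (at_right 0)"
    by (rule LIM_zero_cancel)
  moreover have "\<forall>\<^sub>F t in at_right 0. invertible (similarity_matrix D t)"
    using small by eventually_elim (rule inv)
  ultimately show ?thesis
    using curv by blast
qed

section \<open>The resistance distance is of strict negative type\<close>

definition laplacian :: "'n pair_pre_digraph \<Rightarrow> real ^ 'n \<Rightarrow> real ^ 'n" where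
  "laplacian G p = (\<chi> x. \<Sum>y | (x, y) \<in> parcs G. p $ x - p $ y)"

lemma laplacian_of_bool:
  "laplacian G p $ x = (\<Sum>y\<in>UNIV. of_bool ((x, y) \<in> parcs G) * (p $ x - p $ y))"
  for G :: "'n::finite pair_pre_digraph"
  by (simp add: laplacian_def sum.If_cases of_bool_def if_distrib[of "\<lambda>z. z * _"] cong: if_cong)

lemma linear_laplacian: "linear (laplacian G)"
  for G :: "'n::finite pair_pre_digraph"
  by (rule linearI)
    (auto simp: laplacian_def vec_eq_iff sum_distrib_left algebra_simps simp flip: sum.distrib
      intro!: sum.cong)

text \<open>Exchanging the endpoints of each arc and averaging the two sums gives the Dirichlet
  form; the factor 1/2 appears because each edge occurs as two arcs.\<close>

lemma inner_laplacian:
  fixes G :: "'n::finite pair_pre_digraph"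
  assumes "sym (parcs G)"
  shows "q \<bullet> laplacian G p =
    (\<Sum>x\<in>UNIV. \<Sum>y\<in>UNIV. of_bool ((x, y) \<in> parcs G) * ((p $ x - p $ y) * (q $ x - q $ y))) / 2"
proof -
  let ?f = "\<lambda>x y. of_bool ((x, y) \<in> parcs G) * (p $ x - p $ y) * q $ x"
  have 1: "q \<bullet> laplacian G p = (\<Sum>x\<in>UNIV. \<Sum>y\<in>UNIV. ?f x y)"
    unfolding inner_vec_def laplacian_of_bool inner_real_def sum_distrib_left
    by (simp only: mult_ac)
  also have "\<dots> = (\<Sum>x\<in>UNIV. \<Sum>y\<in>UNIV. ?f y x)"
    by (rule sum.swap)
  also have "\<dots> = (\<Sum>x\<in>UNIV. \<Sum>y\<in>UNIV. of_bool ((x, y) \<in> parcs G) * (p $ y - p $ x) * q $ y)"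
    using assms by (intro sum.cong) (auto simp: sym_def of_bool_def)
  finally have "2 * (q \<bullet> laplacian G p) = (\<Sum>x\<in>UNIV. \<Sum>y\<in>UNIV. ?f x y) + \<dots>"
    using 1 by simp
  then show ?thesis
    by (simp add: algebra_simps flip: sum.distrib)
qed

lemma laplacian_self_adjoint:
  fixes G :: "'n::finite pair_pre_digraph"
  assumes "sym (parcs G)"
  shows "q \<bullet> laplacian G p = laplacian G q \<bullet> p"
  by (simp add: inner_commute[of _ p] inner_laplacian[OF assms] mult_ac)

text \<open>Connectedness is stated through the symmetric closure. Each of its arcs is an arc of
  \<open>G\<close> up to direction, and equality of values ignores direction.\<close>

lemma constant_on_reachable:
  fixes G :: "'n::finite pair_pre_digraph"
  assumes "u \<rightarrow>\<^sup>*\<^bsub>with_proj (mk_symmetric (with_proj G))\<^esub> v"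
    and "\<And>x y. (x, y) \<in> parcs G \<Longrightarrow> f x = f y"
  shows "f u = f v"
  using assms(1) unfolding reachable_def
  by (induct rule: rtrancl_on_induct) (auto simp: parcs_mk_symmetric dest: assms(2))

section \<open>Potentials and effective resistance in a connected network\<close>

locale connected_network =
  fixes G :: "'n::finite pair_pre_digraph"
  assumes sym: "sym (parcs G)"
    and verts: "pverts G = UNIV"
    and conn: "Digraph_Component.connected (with_proj G)"
begin

text \<open>The energy is a sum of squares over arcs, so each potential drop along an arc
  vanishes.\<close>

lemma constant_if_energy_eq_0:
  assumes "p \<bullet> laplacian G p = 0"
  shows "p $ a = p $ b"
proof -
  have "(\<Sum>x\<in>UNIV. \<Sum>y\<in>UNIV. of_bool ((x, y) \<in> parcs G) * ((p $ x - p $ y) * (p $ x - p $ y))) = 0"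
    using assms by (simp add: inner_laplacian[OF sym])
  then have "of_bool ((x, y) \<in> parcs G) * ((p $ x - p $ y) * (p $ x - p $ y)) = 0" for x y
    by (simp add: sum_nonneg_eq_0_iff sum_nonneg)
  then have "p $ x = p $ y" if "(x, y) \<in> parcs G" for x y
    using that by force
  moreover have "a \<rightarrow>\<^sup>*\<^bsub>with_proj (mk_symmetric (with_proj G))\<^esub> b"
    using conn by (simp add: connected_def strongly_connected_def verts)
  ultimately show ?thesis
    by (rule constant_on_reachable[rotated])
qed

lemma unit_current_potential_iff:
  "unit_current_potential G a b p \<longleftrightarrow> laplacian G (\<chi> x. p x) = axis a 1 - axis b 1"
  by (simp add: unit_current_potential_def verts laplacian_def vec_eq_iff axis_def of_bool_def)

text \<open>Two potentials for the same current differ by a vector of zero energy, hence by a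
  constant, so \<open>THE\<close> is well defined.\<close>

lemma effective_resistance_eqI:
  assumes "laplacian G q = axis a 1 - axis b 1"
  shows "effective_resistance G a b = q $ a - q $ b"
  unfolding effective_resistance_def
proof (rule the_equality)
  show "\<exists>p. unit_current_potential G a b p \<and> q $ a - q $ b = p a - p b"
    using assms by (intro exI[of _ "($) q"]) (simp add: unit_current_potential_iff)
next
  fix r assume "\<exists>p. unit_current_potential G a b p \<and> r = p a - p b"
  then obtain p where "laplacian G (\<chi> x. p x) = axis a 1 - axis b 1" and r: "r = p a - p b"
    by (auto simp: unit_current_potential_iff)
  with assms have "laplacian G ((\<chi> x. p x) - q) = 0"
    by (simp add: linear_diff[OF linear_laplacian])
  then have "((\<chi> x. p x) - q) $ a = ((\<chi> x. p x) - q) $ b"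
    by (intro constant_if_energy_eq_0) simp
  then show "r = q $ a - q $ b"
    by (simp add: r)
qed

text \<open>
  Adding the all-ones matrix makes the Laplacian positive definite, and on vectors of sum 0 its
  inverse still inverts the Laplacian.
\<close>
definition grounded :: "real ^ 'n \<Rightarrow> real ^ 'n" where
  "grounded p = laplacian G p + (p \<bullet> 1) *\<^sub>R 1"

lemma linear_grounded: "linear grounded"
  by (rule linearI)
    (simp_all add: grounded_def linear_add[OF linear_laplacian] linear_scale[OF linear_laplacian]
      inner_add_left algebra_simps)

lemma inner_grounded: "q \<bullet> grounded p = q \<bullet> laplacian G p + (p \<bullet> 1) * (q \<bullet> 1)"
  by (simp add: grounded_def inner_add_right)

text \<open>Both summands are nonnegative. If they vanish, \<open>p\<close> is constant with sum
  0.\<close>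

lemma grounded_pos:
  assumes "p \<noteq> 0"
  shows "p \<bullet> grounded p > 0"
proof -
  have nonneg: "p \<bullet> laplacian G p \<ge> 0"
    by (simp add: inner_laplacian[OF sym] sum_nonneg)
  have "p = 0" if "p \<bullet> grounded p = 0"
  proof -
    have "p \<bullet> laplacian G p = 0" and s: "p \<bullet> 1 = 0"
      using that nonneg zero_le_square[of "p \<bullet> 1"] unfolding inner_grounded
      by (auto simp: add_nonneg_eq_0_iff)
    then have const: "p $ x = p $ y" for x y
      by (intro constant_if_energy_eq_0)
    have "p $ x = 0" for x
    proof -
      have "(\<Sum>y\<in>UNIV. p $ y) = (\<Sum>y\<in>(UNIV :: 'n set). p $ x)"
        by (rule sum.cong) (auto intro: const)
      with s show ?thesis
        by (simp add: inner_one_vec)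
    qed
    then show ?thesis
      by (simp add: vec_eq_iff)
  qed
  moreover have "p \<bullet> grounded p \<ge> 0"
    using nonneg by (simp add: inner_grounded)
  ultimately show ?thesis
    using assms by fastforce
qed

lemma grounded_self_adjoint: "q \<bullet> grounded p = grounded q \<bullet> p"
  by (simp add: inner_grounded inner_commute[of _ p] laplacian_self_adjoint[OF sym] mult.commute)

lemma strict_negative_type_resistance_matrix: "strict_negative_type (resistance_matrix G)"
proof -
  have "inj grounded"
    using grounded_pos by (force simp: linear_injective_0[OF linear_grounded])
  then obtain H where H: "linear H" "\<And>p. grounded (H p) = p"
    using linear_injective_isomorphism[OF linear_grounded] by metis
  have H_self_adjoint: "H p \<bullet> q = p \<bullet> H q" for p q
    using grounded_self_adjoint[of "H p" "H q"] by (simp add: H)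
  define h where "h a b = H (axis a 1) \<bullet> axis b 1" for a b
  have h_sym: "h a b = h b a" for a b
    unfolding h_def by (metis H_self_adjoint inner_commute)
  have resistance: "effective_resistance G a b = h a a + h b b - 2 * h a b" for a b
  proof -
    define q where "q = H (axis a 1 - axis b 1)"
    have gq: "grounded q = axis a 1 - axis b 1"
      by (simp add: q_def H)
    \<comment> \<open>Pairing with the all-ones vector kills the Laplacian part, so \<open>q\<close>
      has sum 0 and solves the ungrounded equation too.\<close>
    have "laplacian G 1 = 0"
      by (simp add: laplacian_def vec_eq_iff)
    then have "1 \<bullet> grounded q = (q \<bullet> 1) * real CARD('n)"
      by (simp add: inner_grounded laplacian_self_adjoint[OF sym] inner_one_vec)
    moreover have "1 \<bullet> grounded q = 0"
      by (simp add: gq inner_diff_right inner_axis)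
    ultimately have "laplacian G q = axis a 1 - axis b 1"
      using gq by (simp add: grounded_def)
    then have "effective_resistance G a b = q \<bullet> axis a 1 - q \<bullet> axis b 1"
      by (simp add: effective_resistance_eqI inner_axis)
    then show ?thesis
      using h_sym[of a b] by (simp add: q_def h_def linear_diff[OF H(1)] inner_diff_left)
  qed
  have "u \<bullet> (resistance_matrix G *v u) < 0" if u: "u \<bullet> 1 = 0" "u \<noteq> 0" for u
  proof -
    have "u = (\<Sum>a\<in>UNIV. u $ a *\<^sub>R axis a 1)"
      by (simp add: vec_eq_iff axis_def if_distrib[of "\<lambda>z. _ * z"] cong: if_cong)
    then have Hu: "H u = (\<Sum>a\<in>UNIV. u $ a *\<^sub>R H (axis a 1))"
      by (metis (no_types, lifting) linear_sum[OF H(1)] linear_scale[OF H(1)] sum.cong)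
    have quad: "H u \<bullet> u = (\<Sum>a\<in>UNIV. \<Sum>b\<in>UNIV. u $ a * u $ b * h a b)"
    proof -
      have "H u \<bullet> u = (\<Sum>b\<in>UNIV. u $ b * (H u \<bullet> axis b 1))"
        by (simp add: inner_vec_def[of "H u" u] inner_axis mult.commute)
      also have "\<dots> = (\<Sum>b\<in>UNIV. \<Sum>a\<in>UNIV. u $ a * u $ b * h a b)"
        by (simp add: Hu inner_sum_left h_def sum_distrib_left mult_ac)
      finally show ?thesis
        by (subst sum.swap)
    qed
    have "u \<bullet> (resistance_matrix G *v u) =
        (\<Sum>a\<in>UNIV. \<Sum>b\<in>UNIV. u $ a * u $ b * (h a a + h b b - 2 * h a b))"
      by (simp add: inner_vec_def matrix_vector_mult_def resistance_matrix_def resistance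
          sum_distrib_left mult_ac)
    \<comment> \<open>The two diagonal terms each contain the factor
      \<open>u \<bullet> 1 = 0\<close>; only the cross term survives.\<close>
    also have "\<dots> = (\<Sum>a\<in>UNIV. u $ a * h a a * (\<Sum>b\<in>UNIV. u $ b))
        + (\<Sum>a\<in>UNIV. u $ a * (\<Sum>b\<in>UNIV. u $ b * h b b)) - 2 * (H u \<bullet> u)"
      by (simp add: quad sum_distrib_left algebra_simps sum.distrib sum_subtractf)
    also have "\<dots> = - 2 * (H u \<bullet> u)"
      using u(1) by (simp add: inner_one_vec flip: sum_distrib_right)
    also have "\<dots> < 0"
    proof -
      \<comment> \<open>With \<open>p = H u\<close>, the form \<open>H u \<bullet> u\<close> is
        \<open>p \<bullet> grounded p\<close>.\<close>
      have "H u \<noteq> 0"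
        using H(2)[of u] u(2) linear_0[OF linear_grounded] by auto
      from grounded_pos[OF this] show ?thesis
        by (simp add: H)
    qed
    finally show ?thesis .
  qed
  then show ?thesis
    by (simp add: strict_negative_type_def)
qed

end

section \<open>Application to the resistance matrix of a graph\<close>

theorem theorem5p12:
  fixes G :: "'n::finite pair_pre_digraph"
  assumes "pair_graph G"
    and "pverts G = UNIV"
    and "Digraph_Component.connected (with_proj G)"
  shows "admits_microscopic_weighting (resistance_matrix G) \<and>
         microscopic_weighting (resistance_matrix G) = resistance_curvature G"
proof -
  interpret pair_graph G by fact
  have "sym (parcs G)"
    using sym_arcs by (simp add: symmetric_def)
  then interpret connected_network G
    using assms by unfold_locales auto
  obtain \<kappa> where \<kappa>: "\<And>v. is_resistance_curvature (resistance_matrix G) v \<longleftrightarrow> v = \<kappa>"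
    and "\<forall>\<^sub>F t in at_right 0. invertible (similarity_matrix (resistance_matrix G) t)"
    and lim: "(weighting (resistance_matrix G) \<longlongrightarrow> \<kappa>) (at_right 0)"
    using microscopic_weighting_of_strict_negative_type[OF strict_negative_type_resistance_matrix]
    by blast
  then have "admits_microscopic_weighting (resistance_matrix G)"
    by (auto simp: admits_microscopic_weighting_def)
  moreover have "microscopic_weighting (resistance_matrix G) = \<kappa>"
    unfolding microscopic_weighting_def by (rule tendsto_Lim[OF _ lim]) simp
  moreover have "resistance_curvature G = \<kappa>"
    by (simp add: resistance_curvature_def \<kappa>)
  ultimately show ?thesis
    by simp
qed

end
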